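(* Let $n\ge 1$. The $n$-dimensional spined cube $SQ_n$ is not vertex-transitive unless $n\le 3$; that is, if $SQ_n$ is vertex-transitive then $n\le 3$.
   Context: All graphs are finite, simple and undirected. A graph is vertex-transitive if its automorphism group acts transitively on its vertex set. The spined cube $SQ_n$ ($n\ge 1$) has as vertices the $2^n$ binary strings $x_1x_2\cdots x_n$ and is defined recursively. $SQ_1$ is the complete graph on the two vertices $0$ and $1$. For $n\ge 2$, $SQ_n$ consists of two copies $0SQ_{n-1}$ and $1SQ_{n-1}$ of $SQ_{n-1}$ (every vertex label prefixed by $0$, respectively by $1$), together with the edges joining each vertex $x=0x_2\cdots x_n$ of $0SQ_{n-1}$ to exactly one vertex $x'$ of $1SQ_{n-1}$, where (all sums of bits are modulo 2): $x'=1x_2$ if $n=2$; $x'=1(x_2+x_n)x_3\cdots x_n$ if $n=3$ or $4$; $x'=1(x_2+x_{n-1})(x_3+x_n)x_4\cdots x_n$ if $n\ge 5$. *)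

theory Defs
  imports "Graph_Theory.Graph_Theory" "HOL-Library.Z2"
begin

section \<open>Vertex-transitivity\<close>

text \<open>An automorphism is a library isomorphism of the graph onto itself; \<open>app_iso f G\<close> is the
  image of \<open>G\<close> under \<open>f\<close>.\<close>

definition automorphism ::
  "('a, 'b) pre_digraph \<Rightarrow> ('a, 'b, 'a, 'b) digraph_isomorphism \<Rightarrow> bool" where
  "automorphism G f \<longleftrightarrow> pre_digraph.digraph_isomorphism G f \<and> app_iso f G = G"

definition vertex_transitive :: "('a, 'b) pre_digraph \<Rightarrow> bool" where
  "vertex_transitive G \<longleftrightarrow>
     (\<forall>u \<in> verts G. \<forall>v \<in> verts G. \<exists>f. automorphism G f \<and> iso_verts f u = v)"

text \<open>For graphs whose arcs are pairs of vertices, this is the usual notion: the vertex parts of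
  automorphisms are the adjacency-preserving and -reflecting permutations of the vertex set.\<close>

lemma vertex_transitive_with_proj_iff:
  assumes "pair_wf_digraph G"
  shows "vertex_transitive (with_proj G) \<longleftrightarrow>
    (\<forall>u \<in> pverts G. \<forall>v \<in> pverts G. \<exists>\<phi>. bij_betw \<phi> (pverts G) (pverts G) \<and>
       (\<forall>x \<in> pverts G. \<forall>y \<in> pverts G. (\<phi> x, \<phi> y) \<in> parcs G \<longleftrightarrow> (x, y) \<in> parcs G) \<and> \<phi> u = v)"
    (is "?L \<longleftrightarrow> ?R")
proof -
  interpret pair_wf_digraph G by (rule assms)
  have wf: "wf_digraph (with_proj G)" by (rule wf_digraph)
  show ?thesis
  proof
    assume L: ?L
    show ?R
    proof (intro ballI)
      fix u v assume "u \<in> pverts G" "v \<in> pverts G"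
      with L obtain f where f: "automorphism (with_proj G) f" "iso_verts f u = v"
        unfolding vertex_transitive_def by auto
      let ?p = "iso_verts f"
      have iso: "digraph_isomorphism f" and app: "app_iso f (with_proj G) = with_proj G"
        using f(1) unfolding automorphism_def by auto
      have V: "?p ` pverts G = pverts G"
        using arg_cong[OF app, of verts] by simp
      have A: "iso_arcs f ` parcs G = parcs G"
        using arg_cong[OF app, of arcs] by simp
      have T: "iso_tail f = fst" and H: "iso_head f = snd"
        using arg_cong[OF app, of tail] arg_cong[OF app, of head] by simp_all
      have inj: "inj_on ?p (pverts G)"
        using digraph_isomorphism_inj_on_verts[OF iso] by simp
      have arc: "iso_arcs f (x, y) = (?p x, ?p y)" if "(x, y) \<in> parcs G" for x y
        using iso_verts_tail[OF iso, of "(x, y)"] iso_verts_head[OF iso, of "(x, y)"] that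
        by (simp add: T H prod_eq_iff)
      have "(?p x, ?p y) \<in> parcs G \<longleftrightarrow> (x, y) \<in> parcs G"
        if xy: "x \<in> pverts G" "y \<in> pverts G" for x y
      proof
        assume "(x, y) \<in> parcs G"
        then show "(?p x, ?p y) \<in> parcs G" using arc A by (metis imageI)
      next
        assume "(?p x, ?p y) \<in> parcs G"
        then obtain a b where ab: "(a, b) \<in> parcs G" "iso_arcs f (a, b) = (?p x, ?p y)"
          using A by (metis (no_types, lifting) imageE surj_pair)
        have "a \<in> pverts G" "b \<in> pverts G"
          using ab(1) arc_fst_in_verts arc_snd_in_verts by fastforce+
        then show "(x, y) \<in> parcs G"
          using ab arc xy inj by (metis inj_onD prod.inject)
      qed
      then show "\<exists>\<phi>. bij_betw \<phi> (pverts G) (pverts G) \<and>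
        (\<forall>x \<in> pverts G. \<forall>y \<in> pverts G. (\<phi> x, \<phi> y) \<in> parcs G \<longleftrightarrow> (x, y) \<in> parcs G) \<and> \<phi> u = v"
        using f(2) inj V unfolding bij_betw_def by blast
    qed
  next
    assume R: ?R
    show ?L
      unfolding vertex_transitive_def
    proof (intro ballI)
      fix u v assume "u \<in> verts (with_proj G)" "v \<in> verts (with_proj G)"
      then have "u \<in> pverts G" "v \<in> pverts G" by simp_all
      then obtain p where bij: "bij_betw p (pverts G) (pverts G)"
        and adj: "\<forall>x \<in> pverts G. \<forall>y \<in> pverts G. (p x, p y) \<in> parcs G \<longleftrightarrow> (x, y) \<in> parcs G"
        and uv: "p u = v" using R by blast
      define f where "f = \<lparr>iso_verts = p, iso_arcs = map_prod p p, iso_head = snd, iso_tail = fst\<rparr>"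
      have inj: "inj_on p (pverts G)" and img: "p ` pverts G = pverts G"
        using bij by (auto simp: bij_betw_def)
      have sub: "parcs G \<subseteq> pverts G \<times> pverts G"
        using arc_fst_in_verts arc_snd_in_verts by fastforce
      have "inj_on (map_prod p p) (parcs G)"
        by (rule inj_on_subset[OF map_prod_inj_on[OF inj inj] sub])
      then have iso: "digraph_isomorphism f"
        using wf inj by (auto simp: digraph_isomorphism_def f_def)
      have "map_prod p p ` parcs G = parcs G"
      proof
        show "map_prod p p ` parcs G \<subseteq> parcs G" using adj sub by auto
        show "parcs G \<subseteq> map_prod p p ` parcs G"
        proof
          fix e assume e: "e \<in> parcs G"
          then have "fst e \<in> p ` pverts G" "snd e \<in> p ` pverts G"
            unfolding img using sub by auto
          then obtain x y where xy: "x \<in> pverts G" "y \<in> pverts G" "e = (p x, p y)"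
            by (metis imageE prod.collapse)
          with e adj have "(x, y) \<in> parcs G" by auto
          then show "e \<in> map_prod p p ` parcs G" using xy(3) by force
        qed
      qed
      then have "app_iso f (with_proj G) = with_proj G"
        using img by (simp add: app_iso_def f_def with_proj_def)
      then show "\<exists>f. automorphism (with_proj G) f \<and> iso_verts f u = v"
        using iso uv unfolding automorphism_def by (intro exI[of _ f]) (simp add: f_def)
    qed
  qed
qed


section \<open>Spined cubes\<close>

text \<open>Binary strings $x_1 \ldots x_n$ are lists over the two-element field \<open>bit\<close>, whose addition is
  addition modulo 2. List indexing starts at 0, so $x_i$ is \<open>x ! (i - 1)\<close>.

  The neighbour $x'$ in $1SQ_{n-1}$ of a vertex $x = 0x_2\ldots x_n$ of $0SQ_{n-1}$, where
  $n \ge 2$ is the length of the string; the value is irrelevant for shorter strings.\<close>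

definition spined_partner :: "bit list \<Rightarrow> bit list" where
  "spined_partner x =
    (let n = length x; X = (\<lambda>i. x ! (i - 1)) in
       if n = 2 then [1, X 2]
       else if n = 3 \<or> n = 4 then [1, X 2 + X n] @ drop 2 x
       else [1, X 2 + X (n - 1), X 3 + X n] @ drop 3 x)"

text \<open>An undirected edge is represented by its two opposite arcs. The value at dimension 0 is a
  dummy.\<close>

fun spined_cube :: "nat \<Rightarrow> bit list pair_pre_digraph" where
  "spined_cube 0 = \<lparr>pverts = {[]}, parcs = {}\<rparr>"
| "spined_cube (Suc 0) = \<lparr>pverts = {[0], [1]}, parcs = {([0], [1]), ([1], [0])}\<rparr>"
| "spined_cube (Suc (Suc m)) =
    (let G = spined_cube (Suc m) in
      \<lparr>pverts = (#) 0 ` pverts G \<union> (#) 1 ` pverts G,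
       parcs =
         {(0 # u, 0 # v) | u v. (u, v) \<in> parcs G} \<union>
         {(1 # u, 1 # v) | u v. (u, v) \<in> parcs G} \<union>
         {(0 # u, spined_partner (0 # u)) | u. u \<in> pverts G} \<union>
         {(spined_partner (0 # u), 0 # u) | u. u \<in> pverts G}\<rparr>)"

lemma pverts_spined_cube: "pverts (spined_cube n) = {x. length x = n}"
proof (induction n rule: spined_cube.induct)
  case 1
  show ?case by simp
next
  case 2
  have "x = [0] \<or> x = [1]" if "length x = Suc 0" for x :: "bit list"
    using that by (cases x) (auto intro: bit.exhaust)
  then show ?case by auto
next
  case (3 m)
  have "x \<in> (#) 0 ` {x. length x = Suc m} \<union> (#) 1 ` {x. length x = Suc m}"
    if "length x = Suc (Suc m)" for x :: "bit list"
  proof (cases x)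
    case Nil
    then show ?thesis using that by simp
  next
    case (Cons b y)
    then show ?thesis using that by (cases b) auto
  qed
  then show ?case using 3 by (auto simp: Let_def)
qed

lemma length_spined_partner:
  "length x \<ge> 2 \<Longrightarrow> length (spined_partner x) = length x"
  by (auto simp: spined_partner_def Let_def)

lemma hd_spined_partner: "\<exists>y. spined_partner x = 1 # y"
  by (auto simp: spined_partner_def Let_def)

lemma pair_graph_spined_cube: "pair_graph (spined_cube n)"
proof -
  have "(UNIV :: bit set) = {0, 1}"
    by (auto intro: bit.exhaust)
  then have "finite (UNIV :: bit set)"
    by (metis finite.emptyI finite.insertI)
  then have "finite {x :: bit list. length x = n}"
    using finite_lists_length_eq[of "UNIV :: bit set" n] by simp
  then have fin: "finite (pverts (spined_cube n))"
    by (simp add: pverts_spined_cube)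
  have *: "parcs (spined_cube n) \<subseteq> {x. length x = n} \<times> {x. length x = n} \<and>
    (\<forall>x. (x, x) \<notin> parcs (spined_cube n)) \<and> sym (parcs (spined_cube n))"
  proof (induction n rule: spined_cube.induct)
    case (3 m)
    have "0 # u \<noteq> spined_partner (0 # u)" "spined_partner (0 # u) \<noteq> 0 # u" for u
      using hd_spined_partner[of "0 # u"] by auto
    then show ?case using 3
      by (auto simp: Let_def sym_def pverts_spined_cube length_spined_partner)
  qed (auto simp: sym_def)
  then have fa: "finite (parcs (spined_cube n))"
    using fin by (metis finite_SigmaI finite_subset pverts_spined_cube)
  show ?thesis
    using * fin fa
    by unfold_locales (auto simp: pverts_spined_cube symmetric_def)
qed

end

theory Submission
  imports Defs
begin

text \<open>A vertex-transitive graph looks the same from every vertex, so it suffices to separate the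
  vertices $0 \ldots 00$ and $0 \ldots 01$ by a property that automorphisms preserve. Flipping a bit
  of a string also changes the bits to the right of it, by a twist that is governed by the last two
  bits; at $0 \ldots 00$ this twist is trivial, at $0 \ldots 01$ it is not.

  For $n \ge 5$ the property speaks of $4$-cycles: whether the vertex has three neighbours no two
  of which lie with it on a common $4$-cycle. At $0 \ldots 00$ there is no such triple
  (\<open>three_neighbours_zeros\<close>): the neighbours are the unit vectors. Two of them whose
  nonzero entries lie ahead of the last two positions are on a $4$-cycle with $0 \ldots 00$,
  because the corresponding flips are not twisted there. So are the remaining two unit vectors, and
  among any three unit vectors there is a pair of one of these two kinds. At $0 \ldots 01$
  the flips in positions $n$, $n-2$ and $n-4$ lead to three neighbours of the required kind
  (\<open>common_neighbours_triple\<close>). This is a finite check in dimension $5$, and it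
  propagates to all higher dimensions because a twist is injective: two distinct vertices in one
  half of the cube have no common neighbour in the other half
  (\<open>common_neighbours_Cons\<close>).

  In dimension $4$ the pairs of neighbours that lie on a $4$-cycle with the vertex form the same
  pattern at both vertices, and the property speaks of $5$-cycles instead: whether the vertex
  has a neighbour that lies with neither of two other neighbours on a $5$-cycle through the
  vertex. This holds at $0001$ (\<open>walks3_triple\<close>) and fails at $0000$
  (\<open>walks3_zeros\<close>).\<close>

section \<open>Neighbourhoods in spined cubes\<close>

text \<open>The effect of an edge between the two halves on the string behind the leading bit. The
  case distinction on the length of \<open>w\<close> is the one between dimensions $3, 4$ and
  dimensions $\ge 5$; in dimension $2$ the string is a singleton and the twist is trivial.\<close>

fun twist :: "bit list \<Rightarrow> bit list" where
  "twist (a # b # w) =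
    (if length w < 2 then (a + last (b # w)) # b # w
     else (a + w ! (length w - 2)) # (b + last w) # w)"
| "twist u = u"

lemma spined_partner_Cons: "u \<noteq> [] \<Longrightarrow> spined_partner (0 # u) = 1 # twist u"
proof (cases u rule: twist.cases)
  case (1 a b w)
  then show ?thesis
  proof (cases w)
    case (Cons c w')
    then show ?thesis using 1
      by (cases w') (auto simp: spined_partner_def Let_def last_conv_nth nth_Cons')
  qed (simp add: spined_partner_def Let_def)
qed (simp_all add: spined_partner_def Let_def)

lemma length_twist [simp]: "length (twist u) = length u"
  by (cases u rule: twist.cases) auto

lemma bit_add_add_cancel [simp]: "a + b + b = (a :: bit)"
  by (cases b) auto

text \<open>A twist adds bits that it does not change itself to other bits. Being an involution, it
  describes the edges between the halves in both directions.\<close>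

lemma twist_twist [simp]: "twist (twist u) = u"
  by (cases u rule: twist.cases) auto

lemma twist_eq_iff [simp]: "twist u = twist v \<longleftrightarrow> u = v"
  by (metis twist_twist)

lemma twist_00 [simp]: "twist (u @ [0, 0]) = u @ [0, 0]"
  by (cases u rule: twist.cases) (auto simp: nth_append)

lemma replicate_append_two: "n \<ge> 2 \<Longrightarrow> replicate n a = replicate (n - 2) a @ [a, a]"
proof -
  assume "n \<ge> 2"
  then have "replicate n a = replicate (n - 2) a @ replicate 2 a"
    by (simp only: le_add_diff_inverse2 flip: replicate_add)
  then show ?thesis by (simp only: numeral_2_eq_2 replicate.simps)
qed

lemma twist_zeros [simp]: "twist (replicate n 0) = replicate n 0"
proof (cases "n \<ge> 2")
  case True
  then show ?thesis by (metis replicate_append_two twist_00)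
next
  case False
  then have "n = 0 \<or> n = 1" by auto
  then show ?thesis by auto
qed

fun neighbours :: "bit list \<Rightarrow> bit list set" where
  "neighbours [] = {}"
| "neighbours (b # u) = insert ((b + 1) # twist u) ((#) b ` neighbours u)"

lemma length_neighbours: "y \<in> neighbours x \<Longrightarrow> length y = length x"
  by (induction x arbitrary: y) auto

lemma parcs_spined_cube:
  "n \<ge> 1 \<Longrightarrow> (x, y) \<in> parcs (spined_cube n) \<longleftrightarrow> length x = n \<and> y \<in> neighbours x"
proof (induction n arbitrary: x y rule: spined_cube.induct)
  case 2
  have "a = 0 \<or> a = 1" for a :: bit by (cases a) auto
  then show ?case by (auto simp: length_Suc_conv)
next
  case (3 m)
  show ?case
  proof (cases x)
    case (Cons b u)
    have partner: "spined_partner (0 # w) = 1 # twist w" if "length w = Suc m" for w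
      using that by (intro spined_partner_Cons) auto
    have "(x, y) \<in> parcs (spined_cube (Suc (Suc m))) \<longleftrightarrow>
      (\<exists>v. y = b # v \<and> (u, v) \<in> parcs (spined_cube (Suc m))) \<or>
      (length u = Suc m \<and> y = (b + 1) # twist u)"
      using Cons partner
      by (cases b) (auto simp: Let_def pverts_spined_cube)
    then show ?thesis using 3 Cons by auto
  next
    case Nil
    have "spined_partner w \<noteq> []" for w
      using hd_spined_partner[of w] by auto
    then show ?thesis using 3 Nil
      by (auto simp: Let_def pverts_spined_cube dest: sym)
  qed
qed auto

text \<open>Everything below is expressed by neighbourhoods, unions and intersections of them, and
  this form of the automorphism property carries over to all such expressions at once.\<close>

lemma automorphism_neighbours:
  assumes "vertex_transitive (with_proj (spined_cube n))" "n \<ge> 1"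
    and "length u = n" "length v = n"
  obtains \<phi> where "bij_betw \<phi> {x. length x = n} {x. length x = n}" "\<phi> u = v"
    and "\<And>x. length x = n \<Longrightarrow> \<phi> ` neighbours x = neighbours (\<phi> x)"
proof -
  let ?V = "{x :: bit list. length x = n}"
  obtain \<phi> where \<phi>: "bij_betw \<phi> ?V ?V" "\<phi> u = v"
    and adj: "\<And>x y. length x = n \<Longrightarrow> length y = n \<Longrightarrow>
      \<phi> y \<in> neighbours (\<phi> x) \<longleftrightarrow> y \<in> neighbours x"
  proof -
    interpret pair_graph "spined_cube n" by (rule pair_graph_spined_cube)
    have "pair_wf_digraph (spined_cube n)" by unfold_locales
    from assms(1)[unfolded vertex_transitive_with_proj_iff[OF this]] assms(3,4)
    obtain \<phi> where "bij_betw \<phi> ?V ?V" "\<phi> u = v" and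
      a: "\<forall>x\<in>?V. \<forall>y\<in>?V. (\<phi> x, \<phi> y) \<in> parcs (spined_cube n) \<longleftrightarrow> (x, y) \<in> parcs (spined_cube n)"
      unfolding pverts_spined_cube by blast
    moreover from this have "length (\<phi> x) = n" if "length x = n" for x
      using that by (auto dest: bij_betwE)
    ultimately show thesis
      using that assms(2) by (auto simp: parcs_spined_cube)
  qed
  have "\<phi> ` neighbours x = neighbours (\<phi> x)" if x: "length x = n" for x
  proof
    show "\<phi> ` neighbours x \<subseteq> neighbours (\<phi> x)"
      using adj x length_neighbours by blast
    show "neighbours (\<phi> x) \<subseteq> \<phi> ` neighbours x"
    proof
      fix z assume z: "z \<in> neighbours (\<phi> x)"
      have "length z = n"
        using length_neighbours[OF z] \<phi>(1) x by (auto dest: bij_betwE)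
      then obtain y where "length y = n" "z = \<phi> y"
        using \<phi>(1) unfolding bij_betw_def by blast
      then show "z \<in> \<phi> ` neighbours x" using adj x z by blast
    qed
  qed
  with \<phi> show thesis by (rule that)
qed

section \<open>Common neighbours\<close>

text \<open>A common neighbour in the other half would be a twist of both \<open>p\<close> and
  \<open>q\<close>.\<close>

lemma common_neighbours_Cons:
  "p \<noteq> q \<Longrightarrow>
    neighbours (b # p) \<inter> neighbours (b # q) = (#) b ` (neighbours p \<inter> neighbours q)"
  by (cases b) auto

lemma common_neighbours_append:
  "p \<noteq> q \<Longrightarrow>
    neighbours (w @ p) \<inter> neighbours (w @ q) = (@) w ` (neighbours p \<inter> neighbours q)"
proof (induction w)
  case (Cons b w)
  then show ?case
    using common_neighbours_Cons[of "w @ p" "w @ q" b] by (simp add: image_image)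
qed simp

lemma neighbours_append: "y \<in> neighbours x \<Longrightarrow> w @ y \<in> neighbours (w @ x)"
  by (induction w) auto

text \<open>By \<open>common_neighbours_append\<close> the prefix \<open>w\<close> creates no new common neighbours, which
  leaves a computation in dimension $5$.\<close>

lemma common_neighbours_triple:
  fixes w :: "bit list"
  defines "v \<equiv> w @ [0,0,0,0,1]"
    and "p \<equiv> w @ [0,0,0,0,0]" and "q \<equiv> w @ [0,0,1,1,1]" and "r \<equiv> w @ [1,0,1,0,1]"
  shows "p \<in> neighbours v" "q \<in> neighbours v" "r \<in> neighbours v"
    and "neighbours p \<inter> neighbours q = {v}" "neighbours p \<inter> neighbours r = {v}"
      "neighbours q \<inter> neighbours r = {v}"
  unfolding assms
  by (intro neighbours_append, simp)+ (simp_all add: common_neighbours_append)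

text \<open>The neighbours of $0 \ldots 0$ that do not end in $00$ are $0 \ldots 01$ and
  $0 \ldots 010$, and these have the further common neighbour $0 \ldots 011$. The induction on the
  dimension makes this precise without naming the position of the nonzero entry.\<close>

lemma two_neighbours_zeros:
  assumes "n \<ge> 2"
    and "p \<in> neighbours (replicate n 0)" "q \<in> neighbours (replicate n 0)" "p \<noteq> q"
  shows "neighbours p \<inter> neighbours q \<noteq> {replicate n 0} \<or>
    (\<exists>u. p = u @ [0, 0]) \<or> (\<exists>u. q = u @ [0, 0])"
  using assms
proof (induction n arbitrary: p q rule: nat_induct_at_least)
  case base
  then show ?case by (auto simp: numeral_2_eq_2)
next
  case (Suc n)
  have "1 # replicate n 0 = (1 # replicate (n - 2) 0) @ [0, 0 :: bit]"
    using Suc.hyps by (simp add: replicate_append_two)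
  then have new: "\<exists>u. 1 # replicate n 0 = u @ [0, 0 :: bit]" by blast
  show ?case
  proof (cases "p = 1 # replicate n 0 \<or> q = 1 # replicate n 0")
    case True
    then show ?thesis using new by blast
  next
    case False
    then obtain p' q' where pq: "p = 0 # p'" "q = 0 # q'"
      "p' \<in> neighbours (replicate n 0)" "q' \<in> neighbours (replicate n 0)" "p' \<noteq> q'"
      using Suc.prems by auto
    from Suc.IH[OF pq(3-5)] show ?thesis
    proof (elim disjE exE)
      assume "neighbours p' \<inter> neighbours q' \<noteq> {replicate n 0}"
      then show ?thesis
        unfolding pq common_neighbours_Cons[OF pq(5)] by auto
    qed (use pq in \<open>metis append_Cons\<close>)+
  qed
qed

text \<open>By induction on the dimension only a triple containing the new neighbour
  $10 \ldots 0$ has to be considered. The new neighbour has a second common neighbour with every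
  other neighbour that ends in $00$, so \<open>two_neighbours_zeros\<close>, applied to the other two
  members of the triple, yields the desired pair.\<close>

lemma three_neighbours_zeros:
  assumes "p \<in> neighbours (replicate n 0)" "q \<in> neighbours (replicate n 0)"
    "r \<in> neighbours (replicate n 0)" "p \<noteq> q" "p \<noteq> r" "q \<noteq> r"
  shows "neighbours p \<inter> neighbours q \<noteq> {replicate n 0} \<or>
    neighbours p \<inter> neighbours r \<noteq> {replicate n 0} \<or>
    neighbours q \<inter> neighbours r \<noteq> {replicate n 0}"
  using assms
proof (induction n arbitrary: p q r)
  case (Suc n)
  let ?z = "replicate n (0 :: bit)"
  let ?new = "1 # ?z"
  define L where "L p q \<longleftrightarrow> neighbours p \<inter> neighbours q \<noteq> {0 # ?z}" for p q
  have L_sym: "L p q \<longleftrightarrow> L q p" for p q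
    unfolding L_def by (simp add: Int_commute)
  have L_Cons: "L (0 # p) (0 # q) \<longleftrightarrow> neighbours p \<inter> neighbours q \<noteq> {?z}" if "p \<noteq> q" for p q
    unfolding L_def common_neighbours_Cons[OF that] by (auto simp: inj_image_eq_iff)
  \<comment> \<open>Flips in leading position and in a position ahead of the last two bits commute here.\<close>
  have L_new: "L (0 # u @ [0, 0]) ?new" if "u @ [0, 0] \<in> neighbours ?z" for u
  proof -
    have "1 # u @ [0, 0] \<in> neighbours (0 # u @ [0, 0]) \<inter> neighbours ?new"
      using that by auto
    then show ?thesis unfolding L_def by auto
  qed
  have triple: "L (0 # p) (0 # q) \<or> L (0 # p) ?new \<or> L (0 # q) ?new"
    if "p \<in> neighbours ?z" "q \<in> neighbours ?z" "p \<noteq> q" for p q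
  proof -
    have "n \<ge> 2"
    proof (rule ccontr)
      assume "\<not> n \<ge> 2"
      then have "n = 0 \<or> n = 1" by auto
      then show False using that by auto
    qed
    from two_neighbours_zeros[OF this that] show ?thesis
      using L_new L_Cons that by blast
  qed
  have cases_new: "x = ?new \<or> (\<exists>y \<in> neighbours ?z. x = 0 # y)"
    if "x \<in> neighbours (replicate (Suc n) 0)" for x
    using that by auto
  have old: "L (0 # p) (0 # q) \<or> L (0 # p) (0 # r) \<or> L (0 # q) (0 # r)"
    if "p \<in> neighbours ?z" "q \<in> neighbours ?z" "r \<in> neighbours ?z"
      "p \<noteq> q" "p \<noteq> r" "q \<noteq> r" for p q r
    using Suc.IH[OF that] L_Cons that(4-6) by simp
  consider
      (p) q' r' where "p = ?new" "q = 0 # q'" "r = 0 # r'" "q' \<in> neighbours ?z" "r' \<in> neighbours ?z"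
    | (q) p' r' where "p = 0 # p'" "q = ?new" "r = 0 # r'" "p' \<in> neighbours ?z" "r' \<in> neighbours ?z"
    | (r) p' q' where "p = 0 # p'" "q = 0 # q'" "r = ?new" "p' \<in> neighbours ?z" "q' \<in> neighbours ?z"
    | (none) p' q' r' where "p = 0 # p'" "q = 0 # q'" "r = 0 # r'"
        "p' \<in> neighbours ?z" "q' \<in> neighbours ?z" "r' \<in> neighbours ?z"
    using cases_new[OF Suc.prems(1)] cases_new[OF Suc.prems(2)] cases_new[OF Suc.prems(3)]
      Suc.prems(4-6) by blast
  then have "L p q \<or> L p r \<or> L q r"
  proof cases
    case p
    then show ?thesis using triple[of q' r'] Suc.prems(6) L_sym by auto
  next
    case q
    then show ?thesis using triple[of p' r'] Suc.prems(5) L_sym by auto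
  next
    case r
    then show ?thesis using triple[of p' q'] Suc.prems(4) by auto
  next
    case none
    then show ?thesis using old[of p' q' r'] Suc.prems(4-6) by auto
  qed
  then show ?case by (simp add: L_def)
qed simp

section \<open>Walks of length three in dimension 4\<close>

text \<open>The ends of walks of length three starting at \<open>p\<close>, with repeated vertices allowed.
  For two distinct neighbours \<open>p\<close> and \<open>q\<close> of a vertex \<open>v\<close> in a graph without triangles, a walk of
  length three from \<open>p\<close> to \<open>q\<close> avoids \<open>v\<close> and repeats no vertex, so it exists if and only if
  \<open>p\<close>, \<open>v\<close> and \<open>q\<close> are consecutive on a $5$-cycle.\<close>

definition walks3 :: "bit list \<Rightarrow> bit list set" where
  "walks3 p = (\<Union>x \<in> neighbours p. \<Union>y \<in> neighbours x. neighbours y)"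

lemma length_walks3: "y \<in> walks3 x \<Longrightarrow> length y = length x"
  by (auto simp: walks3_def) (metis length_neighbours)

lemma walks3_triple:
  "[1,1,0,1] \<in> neighbours [0,0,0,1]" "[0,0,1,1] \<in> neighbours [0,0,0,1]"
  "[0,1,1,1] \<in> neighbours [0,0,0,1]"
  "[0,0,1,1] \<notin> walks3 [1,1,0,1]" "[0,1,1,1] \<notin> walks3 [1,1,0,1]"
  by (simp_all add: walks3_def)

text \<open>Only $1000$ and $0010$ are not joined by a walk of length three, and two distinct
  neighbours cannot both form this pair with a third one.\<close>

lemma walks3_zeros:
  assumes "p \<in> neighbours [0,0,0,0]" "q \<in> neighbours [0,0,0,0]" "r \<in> neighbours [0,0,0,0]"
    and "p \<noteq> q" "p \<noteq> r" "q \<noteq> r"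
  shows "q \<in> walks3 p \<or> r \<in> walks3 p"
proof -
  have unit: "neighbours [0,0,0,0] = {[1,0,0,0], [0,1,0,0], [0,0,1,0], [0,0,0,1]}"
    by simp
  have walks:
    "[1,0,0,0] \<in> walks3 [0,1,0,0]" "[1,0,0,0] \<in> walks3 [0,0,0,1]"
    "[0,1,0,0] \<in> walks3 [1,0,0,0]" "[0,1,0,0] \<in> walks3 [0,0,1,0]"
    "[0,1,0,0] \<in> walks3 [0,0,0,1]"
    "[0,0,1,0] \<in> walks3 [0,1,0,0]" "[0,0,1,0] \<in> walks3 [0,0,0,1]"
    "[0,0,0,1] \<in> walks3 [1,0,0,0]" "[0,0,0,1] \<in> walks3 [0,1,0,0]"
    "[0,0,0,1] \<in> walks3 [0,0,1,0]"
    by (simp_all add: walks3_def)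
  show ?thesis
    using assms walks unfolding unit by blast
qed

section \<open>Vertex-transitive spined cubes\<close>

theorem theorem3p8:
  fixes n :: nat
  assumes "n \<ge> 1"
    and "vertex_transitive (with_proj (spined_cube n))"
  shows "n \<le> 3"
proof (rule ccontr)
  assume "\<not> n \<le> 3"
  then consider "n = 4" | "n \<ge> 5" by linarith
  then show False
  proof cases
    case 1
    let ?V = "{x :: bit list. length x = n}"
    let ?p = "[1,1,0,1]" and ?q = "[0,0,1,1]" and ?r = "[0,1,1,1]"
    obtain \<phi> where bij: "bij_betw \<phi> ?V ?V" and \<phi>: "\<phi> [0,0,0,1] = [0,0,0,0]"
      and nb: "\<And>x. length x = n \<Longrightarrow> \<phi> ` neighbours x = neighbours (\<phi> x)"
      by (rule automorphism_neighbours[OF assms(2,1), of "[0,0,0,1]" "[0,0,0,0]"])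
        (use 1 in simp_all)
    have inj: "inj_on \<phi> ?V" using bij by (simp add: bij_betw_def)
    have walks3: "\<phi> ` walks3 x = walks3 (\<phi> x)" if "length x = n" for x
      using that by (simp add: walks3_def image_UN length_neighbours flip: nb)
    have walk_iff: "\<phi> y \<in> walks3 (\<phi> x) \<longleftrightarrow> y \<in> walks3 x" if "length x = n" "length y = n" for x y
      using inj_on_image_mem_iff[OF inj, of y "walks3 x"] that length_walks3
      by (auto simp flip: walks3)
    have "\<phi> ?p \<in> neighbours [0,0,0,0]" "\<phi> ?q \<in> neighbours [0,0,0,0]"
      "\<phi> ?r \<in> neighbours [0,0,0,0]"
      using walks3_triple(1-3) nb[of "[0,0,0,1]"] 1 \<phi> by auto
    moreover have "\<phi> ?p \<noteq> \<phi> ?q" "\<phi> ?p \<noteq> \<phi> ?r" "\<phi> ?q \<noteq> \<phi> ?r"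
      using 1 by (simp_all add: inj_on_eq_iff[OF inj])
    ultimately have "\<phi> ?q \<in> walks3 (\<phi> ?p) \<or> \<phi> ?r \<in> walks3 (\<phi> ?p)"
      by (rule walks3_zeros)
    then show False
      using walks3_triple(4,5) 1 by (simp add: walk_iff)
  next
    case 2
    let ?V = "{x :: bit list. length x = n}"
    let ?w = "replicate (n - 5) (0 :: bit)"
    let ?v = "?w @ [0,0,0,0,1]" and ?p = "?w @ [0,0,0,0,0]"
      and ?q = "?w @ [0,0,1,1,1]" and ?r = "?w @ [1,0,1,0,1]"
    obtain \<phi> where bij: "bij_betw \<phi> ?V ?V" and \<phi>: "\<phi> ?v = replicate n 0"
      and nb: "\<And>x. length x = n \<Longrightarrow> \<phi> ` neighbours x = neighbours (\<phi> x)"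
      by (rule automorphism_neighbours[OF assms(2,1), of ?v "replicate n 0"])
        (use 2 in simp_all)
    have inj: "inj_on \<phi> ?V" using bij by (simp add: bij_betw_def)
    have len: "length ?v = n" "length ?p = n" "length ?q = n" "length ?r = n"
      using 2 by simp_all
    have common: "neighbours (\<phi> x) \<inter> neighbours (\<phi> y) = {replicate n 0}"
      if "length x = n" "length y = n" "neighbours x \<inter> neighbours y = {?v}" for x y
    proof -
      have "\<phi> ` (neighbours x \<inter> neighbours y) = \<phi> ` neighbours x \<inter> \<phi> ` neighbours y"
        by (rule inj_on_image_Int[OF inj]) (use that length_neighbours in auto)
      then show ?thesis using that nb \<phi> by simp
    qed
    have "\<phi> ?p \<in> neighbours (replicate n 0)" "\<phi> ?q \<in> neighbours (replicate n 0)"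
      "\<phi> ?r \<in> neighbours (replicate n 0)"
      using common_neighbours_triple(1-3)[of ?w] nb[OF len(1)] \<phi> by auto
    moreover have "\<phi> ?p \<noteq> \<phi> ?q" "\<phi> ?p \<noteq> \<phi> ?r" "\<phi> ?q \<noteq> \<phi> ?r"
      using len by (simp_all add: inj_on_eq_iff[OF inj])
    ultimately have
      "neighbours (\<phi> ?p) \<inter> neighbours (\<phi> ?q) \<noteq> {replicate n 0} \<or>
       neighbours (\<phi> ?p) \<inter> neighbours (\<phi> ?r) \<noteq> {replicate n 0} \<or>
       neighbours (\<phi> ?q) \<inter> neighbours (\<phi> ?r) \<noteq> {replicate n 0}"
      by (rule three_neighbours_zeros)
    then show False
      using common[OF len(2,3) common_neighbours_triple(4)]
        common[OF len(2,4) common_neighbours_triple(5)]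
        common[OF len(3,4) common_neighbours_triple(6)] by blast
  qed
qed

end
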